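(* Let $\mathcal{A}$ be the set of triples $(a,b,p)\in\mathbb{Z}_{>0}^{3}$ such that $2<p<a<b$, both $p$ and $a$ are prime, $\gcd(a,b)=1$, and $p\nmid b$. There do not exist finitely many rational functions $R_1,\ldots,R_m\in\mathbb{C}(X_1,X_2,X_3)$ such that, for every $(a,b,p)\in\mathcal{A}$, at least one $R_i$ is defined at $(a,b,p)$ and satisfies $$R_i(a,b,p)=g\!\left(\frac{\langle a,b\rangle}{p}\right).$$
   Context: $\mathbb{N}$ denotes the non-negative integers and $\mathbb{Z}_{>0}$ the positive integers. For positive integers $a,b$ with $\gcd(a,b)=1$, $\langle a,b\rangle=\{xa+yb:x,y\in\mathbb{N}\}$. For $S\subseteq\mathbb{N}$ a numerical semigroup (contains $0$, closed under addition, finite complement) and $p\in\mathbb{Z}_{>0}$, $\frac{S}{p}=\{n\in\mathbb{N}:pn\in S\}$; for $S\ne\mathbb{N}$ the Frobenius number is $g(S)=\max(\mathbb{N}\setminus S)$. A rational function, written $A/B$ with $A,B$ polynomials and $B\neq0$, is defined at a point where $B$ does not vanish. *)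

theory Defs
  imports Complex_Main "HOL-Computational_Algebra.Polynomial"
    "HOL-Computational_Algebra.Fraction_Field" "HOL-Computational_Algebra.Primes"
begin

(* C[X1,X2,X3] is the iterated polynomial ring C[X1][X2][X3] (X3 outermost),
   and C(X1,X2,X3) is its field of fractions. *)
type_synonym poly3 = "complex poly poly poly"
type_synonym ratfun3 = "poly3 fract"

definition eval3 :: "poly3 \<Rightarrow> complex \<times> complex \<times> complex \<Rightarrow> complex" where
  "eval3 P = (\<lambda>(x1, x2, x3). poly (poly (poly P [:[:x3:]:]) [:x2:]) x1)"

(* R is defined at z if some way of writing R as A / B has B nonvanishing at z.
   Fract A 0 is 0 by convention in the library, but eval3 B z \<noteq> 0 forces B \<noteq> 0. *)
definition defined_at :: "ratfun3 \<Rightarrow> complex \<times> complex \<times> complex \<Rightarrow> bool" where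
  "defined_at R z \<longleftrightarrow> (\<exists>A B. R = Fract A B \<and> eval3 B z \<noteq> 0)"

(* Only meaningful if defined_at R z; the value does not depend on the representation
   chosen, see value_at_Fract. *)
definition value_at :: "ratfun3 \<Rightarrow> complex \<times> complex \<times> complex \<Rightarrow> complex" where
  "value_at R z =
    (THE v. \<exists>A B. R = Fract A B \<and> eval3 B z \<noteq> 0 \<and> v = eval3 A z / eval3 B z)"

lemma eval3_0 [simp]: "eval3 0 z = 0"
  by (simp add: eval3_def split: prod.split)

lemma eval3_mult: "eval3 (P * Q) z = eval3 P z * eval3 Q z"
  by (simp add: eval3_def split: prod.split)

lemma eval3_vars:
  "eval3 [:[:[:c:]:]:] (x1, x2, x3) = c"
  "eval3 [:[:[:0, 1:]:]:] (x1, x2, x3) = x1"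
  "eval3 [:[:0, 1:]:] (x1, x2, x3) = x2"
  "eval3 [:0, 1:] (x1, x2, x3) = x3"
  by (simp_all add: eval3_def)

lemma value_at_Fract:
  assumes "eval3 B z \<noteq> 0"
  shows "value_at (Fract A B) z = eval3 A z / eval3 B z"
  unfolding value_at_def
proof (rule the_equality)
  show "\<exists>A' B'. Fract A B = Fract A' B' \<and> eval3 B' z \<noteq> 0 \<and>
      eval3 A z / eval3 B z = eval3 A' z / eval3 B' z"
    using assms by blast
next
  fix v
  assume "\<exists>A' B'. Fract A B = Fract A' B' \<and> eval3 B' z \<noteq> 0 \<and> v = eval3 A' z / eval3 B' z"
  then obtain A' B' where *: "Fract A B = Fract A' B'" "eval3 B' z \<noteq> 0"
      "v = eval3 A' z / eval3 B' z"
    by blast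
  have "B \<noteq> 0" "B' \<noteq> 0"
    using assms *(2) by auto
  then have "A * B' = A' * B"
    using *(1) by (simp add: eq_fract)
  then have "eval3 A z * eval3 B' z = eval3 A' z * eval3 B z"
    by (metis eval3_mult)
  then show "v = eval3 A z / eval3 B z"
    using assms *(2) by (simp add: *(3) frac_eq_eq)
qed

definition semigroup_gen2 :: "nat \<Rightarrow> nat \<Rightarrow> nat set" where
  "semigroup_gen2 a b = {x * a + y * b | x y. True}"

definition semigroup_quotient :: "nat set \<Rightarrow> nat \<Rightarrow> nat set" where
  "semigroup_quotient S p = {n. p * n \<in> S}"

(* Meaningful for S \<noteq> UNIV with finite complement. *)
definition frobenius_number :: "nat set \<Rightarrow> nat" where
  "frobenius_number S = Max (UNIV - S)"

definition triples :: "(nat \<times> nat \<times> nat) set" where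
  "triples = {(a, b, p). 2 < p \<and> p < a \<and> a < b \<and> prime p \<and> prime a \<and>
     gcd a b = 1 \<and> \<not> p dvd b}"

end

theory Submission
  imports Defs "HOL-Number_Theory.Cong"
begin

text \<open>
  Fix \<open>p\<close> and \<open>a\<close> with \<open>a\<close> not congruent to 1 modulo \<open>p\<close>. The gaps of the semigroup generated by
  \<open>a\<close> and \<open>b\<close> are the nonnegative numbers \<open>a b - x a - y b\<close> with \<open>x, y \<ge> 1\<close>, so \<open>p\<close> times the
  Frobenius number of the quotient is the largest such number divisible by \<open>p\<close>. If \<open>b > p a\<close>, this
  maximum has \<open>y = 1\<close> and equals \<open>a b - b - r a\<close>, where \<open>r\<close> is determined by the residue of \<open>b\<close>
  modulo \<open>p\<close>; every \<open>r\<close> in \<open>{1..p - 1}\<close> occurs for infinitely many \<open>b\<close>. A rational function whose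
  denominator does not vanish identically on the line \<open>{(a, b, p). b \<in> \<complex>}\<close> can therefore be correct
  infinitely often for at most one \<open>r\<close>. It remains to choose \<open>p > m + 1\<close> and then \<open>a\<close> so that none
  of the \<open>m\<close> denominators vanishes identically on the line.
\<close>

section \<open>Restriction of polynomials to lines in the direction of \<open>X2\<close>\<close>

definition line_poly :: "poly3 \<Rightarrow> complex \<Rightarrow> complex \<Rightarrow> complex poly" where
  "line_poly P x1 x3 = map_poly (\<lambda>q. poly q x1) (poly P [:[:x3:]:])"

lemma poly_map_poly_poly:
  fixes Q :: "'a::comm_ring_1 poly poly"
  shows "poly (map_poly (\<lambda>q. poly q x) Q) y = poly (poly Q [:y:]) x"
  by (induction Q) (auto simp: map_poly_pCons)

lemma poly_line_poly: "poly (line_poly P x1 x3) x2 = eval3 P (x1, x2, x3)"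
  by (simp add: line_poly_def poly_map_poly_poly eval3_def)

text \<open>Only finitely many \<open>p\<close> are roots of \<open>P\<close> in its outermost
  variable. For any other \<open>p\<close>, the leading coefficient in \<open>X2\<close> is a
  nonzero polynomial in \<open>X1\<close> and vanishes at finitely many \<open>a\<close>. These
  depend on \<open>p\<close>, hence the nesting.\<close>

lemma eventually_line_poly_nonzero:
  assumes "P \<noteq> 0"
  shows "\<forall>\<^sub>F p in cofinite. \<forall>\<^sub>F a in cofinite. line_poly P (of_nat a) (of_nat p) \<noteq> 0"
proof -
  have "finite ((\<lambda>p::nat. [:[:of_nat p::complex:]:]) -` {x. poly P x = 0})"
    by (intro finite_vimageI poly_roots_finite assms) (simp add: inj_on_def)
  then have "\<forall>\<^sub>F p::nat in cofinite. poly P [:[:of_nat p:]:] \<noteq> 0"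
    by (simp add: eventually_cofinite vimage_def)
  then show ?thesis
  proof (rule eventually_mono)
    fix p :: nat
    assume nz: "poly P [:[:of_nat p:]:] \<noteq> 0"
    let ?Q = "poly P [:[:of_nat p:]:]"
    have "finite ((of_nat :: nat \<Rightarrow> complex) -` {x. poly (lead_coeff ?Q) x = 0})"
      using nz by (intro finite_vimageI poly_roots_finite) (simp_all add: inj_on_def)
    then have "\<forall>\<^sub>F a::nat in cofinite. poly (lead_coeff ?Q) (of_nat a) \<noteq> 0"
      by (simp add: eventually_cofinite vimage_def)
    then show "\<forall>\<^sub>F a in cofinite. line_poly P (of_nat a) (of_nat p) \<noteq> 0"
    proof (rule eventually_mono)
      fix a :: nat
      assume "poly (lead_coeff ?Q) (of_nat a) \<noteq> 0"
      then have "coeff (line_poly P (of_nat a) (of_nat p)) (degree ?Q) \<noteq> 0"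
        by (simp add: line_poly_def coeff_map_poly)
      then show "line_poly P (of_nat a) (of_nat p) \<noteq> 0" by auto
    qed
  qed
qed

lemma poly_eq_if_infinite:
  fixes p q :: "'a::{comm_ring_1,ring_no_zero_divisors} poly"
  assumes "infinite {x. poly p x = poly q x}"
  shows "p = q"
proof (rule ccontr)
  assume "p \<noteq> q"
  then have "finite {x. poly (p - q) x = 0}" by (intro poly_roots_finite) simp
  then show False using assms by simp
qed

text \<open>
  Clearing denominators makes the equation independent of the representation: it holds even
  at points where \<open>B\<close> vanishes but some other representation of the fraction is defined.
\<close>
lemma value_at_mult_eval3:
  assumes "defined_at (Fract A B) z" "B \<noteq> 0"
  shows "value_at (Fract A B) z * eval3 B z = eval3 A z"
proof -
  obtain A' B' where *: "Fract A B = Fract A' B'" "eval3 B' z \<noteq> 0"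
    using assms(1) by (auto simp: defined_at_def)
  then have "B' \<noteq> 0" by auto
  then have "A * B' = A' * B" using * assms(2) by (simp add: eq_fract)
  then have "eval3 A z * eval3 B' z = eval3 A' z * eval3 B z" by (metis eval3_mult)
  moreover have "eval3 A' z = value_at (Fract A B) z * eval3 B' z"
    using * value_at_Fract by simp
  ultimately show ?thesis using *(2) by simp
qed

section \<open>Primes outside the residue class of 1\<close>

lemma prime_divisor_not_cong_1:
  fixes n p :: nat
  assumes "0 < n" "\<not> [n = 1] (mod p)"
  shows "\<exists>q. prime q \<and> q dvd n \<and> \<not> [q = 1] (mod p)"
proof (rule ccontr)
  assume none: "\<not> ?thesis"
  \<comment> \<open>The class of 1 is closed under products. The induction runs over divisors of
    \<open>n\<close> since \<open>none\<close> only speaks of primes dividing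
    \<open>n\<close>.\<close>
  have "[k = 1] (mod p)" if "k dvd n" for k
    using that
  proof (induction k rule: prime_divisors_induct)
    case zero
    then show ?case using \<open>0 < n\<close> by simp
  next
    case (unit x)
    then show ?case by simp
  next
    case (factor q x)
    have "[x = 1] (mod p)" using factor by (meson dvd_mult_right)
    moreover have "[q = 1] (mod p)" using factor none by (meson dvd_mult_left)
    ultimately show ?case using cong_mult[of q 1 p x 1] by simp
  qed
  from this[OF dvd_refl] show False using assms(2) by contradiction
qed

text \<open>Euclid's argument: all prime divisors of \<open>p * fact N - 1\<close> exceed
  \<open>N\<close>, and one of them lies outside the class of 1 because this number is -1 modulo
  \<open>p\<close>, where -1 differs from 1.\<close>

lemma infinite_primes_not_cong_1:
  fixes p :: nat
  assumes "2 < p"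
  shows "infinite {q. prime q \<and> \<not> [q = 1] (mod p)}"
  unfolding infinite_nat_iff_unbounded
proof
  fix N :: nat
  define n where "n = p * fact N - 1"
  have Suc_n: "Suc n = p * fact N" using assms by (simp add: n_def)
  have "p * 1 \<le> p * fact N" by (intro mult_le_mono2) (rule fact_ge_1)
  then have "0 < n" using assms unfolding Suc_n[symmetric] by linarith
  have "\<not> [n = 1] (mod p)"
  proof
    assume "[n = 1] (mod p)"
    then have "[Suc n = 2] (mod p)"
      using cong_add_rcancel_nat[of n 1 1 p] by (simp add: numeral_2_eq_2)
    then have "p dvd Suc n \<longleftrightarrow> p dvd 2" by (rule cong_dvd_iff)
    then have "p dvd 2" by (simp add: Suc_n)
    then show False using assms by (auto dest: dvd_imp_le)
  qed
  then obtain q where q: "prime q" "q dvd n" "\<not> [q = 1] (mod p)"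
    using prime_divisor_not_cong_1 \<open>0 < n\<close> by blast
  have "N < q"
  proof (rule ccontr)
    assume "\<not> N < q"
    then have "q dvd Suc n"
      unfolding Suc_n using q(1) by (intro dvd_mult dvd_fact prime_ge_1_nat) auto
    then have "q dvd 1" using q(2) by (metis dvd_add_right_iff Suc_eq_plus1)
    then show False using q(1) by (metis not_prime_unit)
  qed
  then show "\<exists>q>N. q \<in> {q. prime q \<and> \<not> [q = 1] (mod p)}" using q by blast
qed

section \<open>The Frobenius number of the quotient\<close>

lemma frobenius_number_quotient_gen2:
  fixes a b p r n :: nat
  assumes "coprime a b" "coprime a p" "0 < a" "0 < r" "r < p" "p * a < b"
    and n: "p * n + b + r * a = a * b"
  shows "frobenius_number (semigroup_quotient (semigroup_gen2 a b) p) = n"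
  unfolding frobenius_number_def
proof (rule Max_eqI)
  have le: "k \<le> n" if k: "k \<in> UNIV - semigroup_quotient (semigroup_gen2 a b) p" for k
  proof -
    have notin: "p * k \<noteq> x * a + y * b" for x y
      using k by (auto simp: semigroup_quotient_def semigroup_gen2_def)
    obtain z where z: "[b * z = 1] (mod a)"
      using cong_solve_coprime_nat[of b a] assms(1) by (auto simp: coprime_commute)
    \<comment> \<open>The residue of \<open>p * k / b\<close> modulo \<open>a\<close>. As
      \<open>p * k\<close> is a gap, this forces \<open>p * k = y * b - l * a\<close> with
      \<open>y < a\<close> and \<open>l > 0\<close>.\<close>
    define y where "y = (p * k * z) mod a"
    have "[y * b = p * k * z * b] (mod a)"
      unfolding y_def by (intro cong_mult cong_refl) (simp add: cong_def)
    also have "[p * k * z * b = p * k * 1] (mod a)"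
      using cong_mult[OF cong_refl[of "p * k" a] z] by (simp add: mult_ac)
    finally have y_cong: "[y * b = p * k] (mod a)" by simp
    have "\<not> y * b \<le> p * k"
    proof
      assume "y * b \<le> p * k"
      then obtain x where "p * k = y * b + x * a"
        using cong_sym[OF y_cong] by (auto simp: cong_le_nat add.commute)
      then show False using notin[of x y] by simp
    qed
    then have "p * k \<le> y * b" "p * k < y * b" by auto
    then obtain l where l: "y * b = p * k + l * a"
      using y_cong by (auto simp: cong_le_nat add.commute)
    have "l > 0" using l \<open>p * k < y * b\<close> by (cases l) auto
    have "y < a" using \<open>0 < a\<close> by (simp add: y_def)
    have ra: "r * a < b"
      using assms(5,6) mult_le_mono1[of r p a] by linarith
    have "p * k \<le> p * n"
    proof (cases "Suc y = a")
      case True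
      then have ab: "a * b = p * k + l * a + b" using l by auto
      then have eq: "p * k + l * a = p * n + r * a" using n by simp
      have "[l * a = r * a] (mod p)"
        using arg_cong[OF eq, of "\<lambda>t. t mod p"] by (simp add: cong_def)
      then have "[l = r] (mod p)"
        using assms(2) by (metis cong_mult_rcancel_nat coprime_commute)
      \<comment> \<open>As \<open>r < p\<close>, \<open>r\<close> is the remainder of
        \<open>l\<close> modulo \<open>p\<close>.\<close>
      then have "r \<le> l" using \<open>r < p\<close> mod_less_eq_dividend[of l p] by (simp add: cong_def)
      then have "r * a \<le> l * a" by simp
      then show ?thesis using eq by linarith
    next
      \<comment> \<open>Now \<open>p * k\<close> lies below \<open>a * b - 2 * b\<close>, and the
        second \<open>b\<close> outweighs \<open>r * a\<close>.\<close>
      case False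
      then have "Suc (Suc y) \<le> a" using \<open>y < a\<close> by simp
      then have "Suc (Suc y) * b \<le> a * b" by (rule mult_le_mono1)
      then have "y * b + 2 * b \<le> a * b" by simp
      then show ?thesis using l n ra by linarith
    qed
    then show "k \<le> n" using assms(5) by simp
  qed
  then show "finite (UNIV - semigroup_quotient (semigroup_gen2 a b) p)"
    by (intro finite_subset[OF _ finite_atMost[of n]] subsetI) simp
  show "k \<le> n" if "k \<in> UNIV - semigroup_quotient (semigroup_gen2 a b) p" for k
    using le that .
  \<comment> \<open>A representation of \<open>p * n\<close> would write \<open>a * b\<close> as a
    combination of \<open>a\<close> and \<open>b\<close> with both coefficients positive, impossible
    for coprime \<open>a\<close> and \<open>b\<close>.\<close>
  have False if "p * n = x * a + y * b" for x y
  proof -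
    have eq: "(x + r) * a + Suc y * b = a * b"
      using n that by (simp add: algebra_simps)
    have "a dvd (x + r) * a + Suc y * b" unfolding eq by simp
    then have "a dvd Suc y * b" by (metis dvd_add_right_iff dvd_triv_right)
    then have "a dvd Suc y" using assms(1) by (metis coprime_dvd_mult_left_iff)
    then have "a \<le> Suc y" by (rule dvd_imp_le) simp
    then have "a * b \<le> Suc y * b" by (rule mult_le_mono1)
    moreover have "0 < (x + r) * a" using assms(3,4) by simp
    ultimately show False using eq by linarith
  qed
  then show "n \<in> UNIV - semigroup_quotient (semigroup_gen2 a b) p"
    by (auto simp: semigroup_quotient_def semigroup_gen2_def)
qed

section \<open>Counting the values of \<open>r\<close> against the rational functions\<close>

theorem corollary4p7:
  "\<not> (\<exists>(m::nat) (R :: nat \<Rightarrow> ratfun3). \<forall>(a, b, p) \<in> triples. \<exists>i\<in>{1..m}.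
      defined_at (R i) (of_nat a, of_nat b, of_nat p) \<and>
      value_at (R i) (of_nat a, of_nat b, of_nat p) =
        of_nat (frobenius_number (semigroup_quotient (semigroup_gen2 a b) p)))"
proof
  let ?g = "\<lambda>a b p. frobenius_number (semigroup_quotient (semigroup_gen2 a b) p)"
  assume "\<exists>(m::nat) (R :: nat \<Rightarrow> ratfun3). \<forall>(a, b, p) \<in> triples. \<exists>i\<in>{1..m}.
      defined_at (R i) (of_nat a, of_nat b, of_nat p) \<and>
      value_at (R i) (of_nat a, of_nat b, of_nat p) = of_nat (?g a b p)"
  then obtain m :: nat and R :: "nat \<Rightarrow> ratfun3" where R:
    "\<And>a b p. (a, b, p) \<in> triples \<Longrightarrow> \<exists>i\<in>{1..m}.
      defined_at (R i) (of_nat a, of_nat b, of_nat p) \<and>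
      value_at (R i) (of_nat a, of_nat b, of_nat p) = of_nat (?g a b p)"
    by fast
  have "\<forall>i. \<exists>A B. R i = Fract A B \<and> B \<noteq> 0" by (metis Fract_cases)
  then obtain A B where AB: "\<And>i. R i = Fract (A i) (B i)" "\<And>i. B i \<noteq> 0" by metis

  have "\<forall>\<^sub>F p in cofinite. \<forall>i\<in>{1..m}.
      \<forall>\<^sub>F a in cofinite. line_poly (B i) (of_nat a) (of_nat p) \<noteq> 0"
    using AB(2) by (intro eventually_ball_finite) (auto intro: eventually_line_poly_nonzero)
  moreover have "\<forall>\<^sub>F p::nat in cofinite. m + 2 < p"
    using eventually_gt_at_top[of "m + 2"] by (simp add: cofinite_eq_sequentially)
  ultimately have "\<forall>\<^sub>F p in cofinite. m + 2 < p \<and> (\<forall>i\<in>{1..m}.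
      \<forall>\<^sub>F a in cofinite. line_poly (B i) (of_nat a) (of_nat p) \<noteq> 0)"
    by eventually_elim simp
  moreover have "\<exists>\<^sub>F p::nat in cofinite. prime p"
    using primes_infinite by (simp add: frequently_cofinite)
  ultimately obtain p :: nat where p: "prime p" "m + 2 < p"
    and line_p: "\<forall>i\<in>{1..m}. \<forall>\<^sub>F a in cofinite. line_poly (B i) (of_nat a) (of_nat p) \<noteq> 0"
    using frequently_ex[OF frequently_eventually_conj] by blast

  have "\<forall>\<^sub>F a in cofinite. \<forall>i\<in>{1..m}. line_poly (B i) (of_nat a) (of_nat p) \<noteq> 0"
    using line_p by (intro eventually_ball_finite) auto
  moreover have "\<forall>\<^sub>F a::nat in cofinite. p < a"
    using eventually_gt_at_top[of p] by (simp add: cofinite_eq_sequentially)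
  ultimately have "\<forall>\<^sub>F a in cofinite. p < a \<and>
      (\<forall>i\<in>{1..m}. line_poly (B i) (of_nat a) (of_nat p) \<noteq> 0)"
    by eventually_elim simp
  moreover have "\<exists>\<^sub>F a::nat in cofinite. prime a \<and> \<not> [a = 1] (mod p)"
    using infinite_primes_not_cong_1[of p] p by (simp add: frequently_cofinite)
  ultimately obtain a :: nat where a: "prime a" "\<not> [a = 1] (mod p)" "p < a"
    and line_a: "\<forall>i\<in>{1..m}. line_poly (B i) (of_nat a) (of_nat p) \<noteq> 0"
    using frequently_ex[OF frequently_eventually_conj] by blast

  have "2 < p" using p by simp
  have infinite_eq: "infinite {b. (a, b, p) \<in> triples \<and> p * ?g a b p + b + r * a = a * b}"
    if r: "0 < r" "r < p" for r
    unfolding infinite_nat_iff_unbounded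
  proof
    fix N :: nat
    have cop: "coprime a p" using p a \<open>2 < p\<close> by (simp add: primes_coprime)
    have "\<not> p dvd a - 1" using p a \<open>2 < p\<close> by (simp add: cong_altdef_nat)
    then have "coprime (a - 1) p"
      using p(1) by (simp add: prime_imp_coprime coprime_commute)
    \<comment> \<open>The inverse of \<open>a - 1\<close> exists as \<open>a\<close> is not 1 modulo
      \<open>p\<close>. It solves \<open>(a - 1) * b = r * a\<close> modulo \<open>p\<close>, which
      makes \<open>a * b - b - r * a\<close> divisible by \<open>p\<close>.\<close>
    then obtain c where c: "[(a - 1) * c = 1] (mod p)"
      using cong_solve_coprime_nat by auto
    obtain b0 where b0: "[b0 = c * (r * a)] (mod p)" "[b0 = 1] (mod a)"
      using binary_chinese_remainder_nat cop coprime_commute by blast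
    have "0 < a" using a(3) by linarith
    obtain k where k: "N < k" "1 < k" using gt_ex[of "max N 1"] by auto
    \<comment> \<open>Multiples of \<open>p * a\<close> preserve both residues; \<open>k\<close>
      makes \<open>b\<close> exceed \<open>N\<close> and \<open>p * a\<close>.\<close>
    define b where "b = b0 + (p * a) * k"
    have bp: "[b = c * (r * a)] (mod p)" using b0(1) by (simp add: b_def cong_def mult.assoc)
    have ba: "[b = 1] (mod a)"
      using b0(2) by (simp add: b_def cong_def mult.assoc mult.left_commute[of p])
    have "(p * a) * k \<le> b" by (simp add: b_def)
    moreover have "1 * k \<le> (p * a) * k"
      using p a \<open>2 < p\<close> by (intro mult_le_mono1) simp
    moreover have "(p * a) * 1 < (p * a) * k"
      using \<open>2 < p\<close> \<open>0 < a\<close> k by (intro mult_strict_left_mono) simp_all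
    ultimately have "N < b" "p * a < b" using k by linarith+
    have "a < b"
      using \<open>p * a < b\<close> mult_le_mono1[of 1 p a] \<open>2 < p\<close> by linarith
    have "coprime a b" using ba by (metis cong_imp_coprime coprime_1_left coprime_commute cong_sym)
    have "[(a - 1) * b = (a - 1) * (c * (r * a))] (mod p)" using bp by (intro cong_mult cong_refl)
    also have "[(a - 1) * (c * (r * a)) = 1 * (r * a)] (mod p)"
      using cong_mult[OF c cong_refl[of "r * a" p]] by (simp add: mult_ac)
    finally have main: "[(a - 1) * b = r * a] (mod p)" by simp
    have "\<not> p dvd b"
    proof
      assume "p dvd b"
      then have "p dvd r * a" using main by (metis cong_dvd_iff dvd_mult)
      then have "p dvd r"
        using cop by (simp add: coprime_dvd_mult_left_iff coprime_commute)
      then show False using r by (meson dvd_imp_le not_less)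
    qed
    have "r * a < b" using \<open>p * a < b\<close> mult_le_mono1[of r p a] r(2) by linarith
    also have "1 * b \<le> (a - 1) * b" using p a \<open>2 < p\<close> by (intro mult_le_mono1) simp
    finally have "r * a \<le> (a - 1) * b" by simp
    then obtain n where n: "(a - 1) * b = n * p + r * a"
      using main by (auto simp: cong_le_nat)
    have "a * b = (a - 1) * b + b" using p a \<open>2 < p\<close> by (cases a) auto
    then have eq: "p * n + b + r * a = a * b" using n by (simp add: mult.commute)
    then have "frobenius_number (semigroup_quotient (semigroup_gen2 a b) p) = n"
      by (rule frobenius_number_quotient_gen2[OF \<open>coprime a b\<close> cop \<open>0 < a\<close> r \<open>p * a < b\<close>])
    moreover have "(a, b, p) \<in> triples"
      using p a \<open>2 < p\<close> \<open>a < b\<close> \<open>coprime a b\<close> \<open>\<not> p dvd b\<close> by (simp add: triples_def)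
    ultimately show "\<exists>b>N. b \<in> {b. (a, b, p) \<in> triples \<and>
      p * frobenius_number (semigroup_quotient (semigroup_gen2 a b) p) + b + r * a = a * b}"
      using eq \<open>N < b\<close> by blast
  qed

  let ?A = "\<lambda>i. line_poly (A i) (of_nat a) (of_nat p)"
  let ?B = "\<lambda>i. line_poly (B i) (of_nat a) (of_nat p)"
  \<comment> \<open>On the line, \<open>?L r\<close> is \<open>p\<close> times the Frobenius number
    as a polynomial in \<open>b\<close>.\<close>
  let ?L = "\<lambda>r::nat. [:- of_nat (r * a), of_nat a - 1:] :: complex poly"
  have "\<exists>i\<in>{1..m}. smult (of_nat p) (?A i) = ?L r * ?B i" if r: "r \<in> {1..<p}" for r
  proof -
    let ?S = "{b. (a, b, p) \<in> triples \<and> p * ?g a b p + b + r * a = a * b}"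
    let ?G = "\<lambda>i. {b. poly (smult (of_nat p) (?A i)) (of_nat b) = poly (?L r * ?B i) (of_nat b)}"
    have "infinite ?S" using r by (intro infinite_eq) auto
    moreover have "?S \<subseteq> (\<Union>i\<in>{1..m}. ?G i)"
    proof
      fix b assume b: "b \<in> ?S"
      let ?z = "(of_nat a, of_nat b, of_nat p) :: complex \<times> complex \<times> complex"
      obtain i where i: "i \<in> {1..m}" "defined_at (R i) ?z"
        "value_at (R i) ?z = of_nat (?g a b p)"
        using R b by blast
      have "of_nat (?g a b p) * eval3 (B i) ?z = eval3 (A i) ?z"
        using value_at_mult_eval3[of "A i" "B i" ?z] i(2,3) AB by metis
      moreover have "(of_nat (p * ?g a b p + b + r * a) :: complex) = of_nat (a * b)"
        using b by (intro arg_cong[of _ _ of_nat]) simp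
      then have "of_nat p * of_nat (?g a b p) = poly (?L r) (of_nat b)"
        by (simp add: algebra_simps)
      ultimately have "of_nat p * eval3 (A i) ?z = poly (?L r) (of_nat b) * eval3 (B i) ?z"
        by (metis mult.assoc)
      then have "b \<in> ?G i" by (simp only: mem_Collect_eq poly_smult poly_mult poly_line_poly)
      then show "b \<in> (\<Union>i\<in>{1..m}. ?G i)" using i(1) by blast
    qed
    \<comment> \<open>By pigeonhole a single \<open>i\<close> serves infinitely many
      \<open>b\<close>, which turns the equation into a polynomial identity.\<close>
    ultimately obtain i where i: "i \<in> {1..m}" "infinite (?G i)"
      by (meson finite_UN_I finite_atLeastAtMost finite_subset)
    have "infinite ((of_nat :: nat \<Rightarrow> complex) ` ?G i)"
      using i(2) by (simp add: finite_image_iff inj_on_def)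
    moreover have "of_nat ` ?G i \<subseteq> {x. poly (smult (of_nat p) (?A i)) x = poly (?L r * ?B i) x}"
      by blast
    ultimately have "smult (of_nat p) (?A i) = ?L r * ?B i"
      using poly_eq_if_infinite infinite_super by blast
    then show ?thesis using i(1) by blast
  qed
  then obtain f where f: "\<And>r. r \<in> {1..<p} \<Longrightarrow> f r \<in> {1..m}"
    "\<And>r. r \<in> {1..<p} \<Longrightarrow> smult (of_nat p) (?A (f r)) = ?L r * ?B (f r)"
    by metis
  have "inj_on f {1..<p}"
  proof (rule inj_onI)
    fix r s assume rs: "r \<in> {1..<p}" "s \<in> {1..<p}" "f r = f s"
    then have "?L r * ?B (f r) = ?L s * ?B (f r)" using f(2) by metis
    \<comment> \<open>Cancellation is where the choice of \<open>a\<close> by \<open>line_a\<close>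
      enters.\<close>
    then have "?L r = ?L s" using line_a f(1) rs(1) by (metis mult_right_cancel)
    then have "of_nat (r * a) = (of_nat (s * a) :: complex)" by (simp del: of_nat_mult)
    then have "r * a = s * a" by (simp only: of_nat_eq_iff)
    then show "r = s" using a by simp
  qed
  \<comment> \<open>There are \<open>p - 1 > m\<close> values of \<open>r\<close>.\<close>
  then have "card {1..<p} \<le> card {1..m}"
    using f(1) by (intro card_inj_on_le[of f]) auto
  then show False using p by simp
qed

end
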